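(* For every integer $c\ge1$ there is a finite $c$-connected graph that is strongly non-stackable.
   Context: Cup stacking on a finite connected graph: initially one cup on every vertex; a move takes all $r\ge1$ cups from a vertex $x$ onto a vertex $y\neq x$ that already carries at least one cup and satisfies $d(x,y)=r$ (shortest-path distance). A graph is $t$-stackable if some sequence of moves ends with all cups on $t$; it is strongly non-stackable if it is not $t$-stackable for any vertex $t$. *)

theory Defs
  imports "Graph_Theory.Graph_Theory"
begin

text \<open>
  A finite simple undirected graph is a symmetric loop-free digraph without parallel arcs,
  that is, an instance of the locale \<open>graph\<close> (or \<open>pair_graph\<close>), each edge being
  represented by its two orientations.
\<close>

text \<open>
  The standard convention for \<open>c\<close>-connectivity: more than \<open>c\<close> vertices, and no
  deletion of fewer than \<open>c\<close> vertices disconnects the graph.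
\<close>
definition vertex_connected :: "nat \<Rightarrow> ('a, 'b) pre_digraph \<Rightarrow> bool" where
  "vertex_connected c G \<longleftrightarrow>
     card (verts G) > c \<and>
     (\<forall>S \<subseteq> verts G. card S < c \<longrightarrow> Digraph_Component.connected (G \<restriction> (verts G - S)))"

text \<open>The number of edges on a shortest path (\<open>\<infinity>\<close> if there is none).\<close>
abbreviation graph_dist :: "('a, 'b) pre_digraph \<Rightarrow> 'a \<Rightarrow> 'a \<Rightarrow> ereal" where
  "graph_dist G \<equiv> wf_digraph.\<mu> G (\<lambda>_. 1)"

text \<open>A configuration \<open>C\<close> assigns to each vertex the number of cups on it.\<close>

definition initial_cups :: "('a, 'b) pre_digraph \<Rightarrow> 'a \<Rightarrow> nat" where
  "initial_cups G = (\<lambda>v. if v \<in> verts G then 1 else 0)"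

definition cup_move :: "('a, 'b) pre_digraph \<Rightarrow> ('a \<Rightarrow> nat) \<Rightarrow> ('a \<Rightarrow> nat) \<Rightarrow> bool" where
  "cup_move G C C' \<longleftrightarrow>
     (\<exists>x \<in> verts G. \<exists>y \<in> verts G. x \<noteq> y \<and> C x \<ge> 1 \<and> C y \<ge> 1 \<and>
        graph_dist G x y = ereal (real (C x)) \<and>
        C' = C(x := 0, y := C y + C x))"

definition stackable :: "('a, 'b) pre_digraph \<Rightarrow> 'a \<Rightarrow> bool" where
  "stackable G t \<longleftrightarrow>
     (\<exists>C. (cup_move G)\<^sup>*\<^sup>* (initial_cups G) C \<and> (\<forall>v \<in> verts G. v \<noteq> t \<longrightarrow> C v = 0))"

definition strongly_non_stackable :: "('a, 'b) pre_digraph \<Rightarrow> bool" where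
  "strongly_non_stackable G \<longleftrightarrow> (\<forall>t \<in> verts G. \<not> stackable G t)"

end

theory Submission
  imports Defs
begin

text \<open>
  In a graph of diameter at most 2, a stack of three or more cups never moves again. So every cup
  on a vertex not adjacent to the target \<open>t\<close> must reach \<open>t\<close> in a stack of two, formed by merging
  it with the cup of a neighbour. Hence \<open>t\<close> cannot be the target if some independent set of
  non-neighbours of \<open>t\<close> has fewer neighbours than elements. To arrange this for every \<open>t\<close>
  while keeping the graph highly connected, take a clique of \<open>k = c + 2\<close> vertices and, for each
  clique vertex \<open>i\<close>, attach \<open>k\<close> new vertices to the whole clique except \<open>i\<close>.
\<close>

section \<open>Stacking in graphs of diameter at most two\<close>

context wf_digraph
begin

lemma awalk_cost_one: "awalk_cost (\<lambda>_. 1) p = real (length p)"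
  by (induction p) auto

text \<open>The distance is an infimum over walks. Between distinct non-adjacent vertices every walk
  has at least two arcs, so the infimum cannot be 1.\<close>

lemma graph_dist_eq_1_imp_adj:
  assumes "x \<noteq> y" and dist: "graph_dist G x y = 1"
  shows "x \<rightarrow>\<^bsub>G\<^esub> y"
proof (rule ccontr)
  assume nadj: "\<not> x \<rightarrow>\<^bsub>G\<^esub> y"
  have "length p \<ge> 2" if "awalk x p y" for p
  proof (rule ccontr)
    assume "\<not> length p \<ge> 2"
    then consider "p = []" | e where "p = [e]"
      by (cases p; cases "tl p") auto
    then show False
      using that nadj \<open>x \<noteq> y\<close> by cases (auto simp: awalk_simps in_arcs_imp_in_arcs_ends)
  qed
  then have "2 \<le> graph_dist G x y"
    unfolding \<mu>_def awalk_cost_one by (intro INF_greatest) auto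
  with dist show False by simp
qed

lemma graph_dist_le_2:
  assumes "x \<rightarrow>\<^bsub>G\<^esub> z" "z \<rightarrow>\<^bsub>G\<^esub> y"
  shows "graph_dist G x y \<le> 2"
proof -
  obtain e where "e \<in> arcs G" "tail G e = x" "head G e = z"
    using assms(1) by (auto simp: arcs_ends_conv)
  moreover obtain f where "f \<in> arcs G" "tail G f = z" "head G f = y"
    using assms(2) by (auto simp: arcs_ends_conv)
  ultimately have "awalk x [e, f] y"
    by (auto simp: awalk_simps)
  then show ?thesis
    using min_cost_le_walk_cost[of x "[e, f]" y "\<lambda>_. 1"] by simp
qed

text \<open>Single cups are never created. Unless a stack gets stuck away from \<open>t\<close>,
  each single cup that disappears from \<open>T\<close> uses up one in \<open>B\<close>, so the
  initial deficit of \<open>B\<close> lasts and \<open>T\<close> can never be cleared.\<close>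

lemma not_stackable_if_few_neighbours:
  assumes diam: "\<And>x y. x \<in> verts G \<Longrightarrow> y \<in> verts G \<Longrightarrow> graph_dist G x y \<le> 2"
    and fin: "finite (verts G)"
    and sub: "T \<subseteq> verts G" "B \<subseteq> verts G"
    and t: "t \<notin> T" "t \<notin> B"
    and disj: "T \<inter> B = {}"
    and adj: "\<And>x y. x \<rightarrow>\<^bsub>G\<^esub> y \<Longrightarrow> x \<in> T \<Longrightarrow> y \<in> B" "\<And>x y. x \<rightarrow>\<^bsub>G\<^esub> y \<Longrightarrow> y \<in> T \<Longrightarrow> x \<in> B"
    and card: "card B < card T"
  shows "\<not> stackable G t"
proof
  define single where "single C A = {v \<in> A. C v = (1::nat)}" for C and A :: "'a set"
  \<comment> \<open>The invariant: either a stack too large to move stands off \<open>t\<close>, or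
    too few partners remain in \<open>B\<close>.\<close>
  define blocked where "blocked C \<longleftrightarrow>
    (\<exists>z \<in> verts G. z \<noteq> t \<and> C z \<ge> 3) \<or> card (single C B) < card (single C T)" for C
  have finB: "finite B" and finT: "finite T"
    using fin sub finite_subset by blast+
  have step: "blocked C'" if move: "cup_move G C C'" and bl: "blocked C" for C C'
  proof (rule ccontr)
    assume nb: "\<not> blocked C'"
    obtain x y where xy: "x \<in> verts G" "y \<in> verts G" "x \<noteq> y" "C x \<ge> 1" "C y \<ge> 1"
      and d: "graph_dist G x y = ereal (real (C x))"
      and C': "C' = C(x := 0, y := C y + C x)"
      using move unfolding cup_move_def by blast
    have Cx: "C x \<le> 2" using diam[OF xy(1,2)] d by simp
    have small: "C' z < 3" if "z \<in> verts G" "z \<noteq> t" for z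
      using nb that unfolding blocked_def by (meson not_less)
    \<comment> \<open>A stack of three or more cannot be the moving one, so it would survive in
      \<open>C'\<close>, contradicting \<open>small\<close>.\<close>
    have "\<not> C z \<ge> 3" if "z \<in> verts G" "z \<noteq> t" for z
      using small[OF that] Cx xy unfolding C' by (auto split: if_splits)
    with bl have lt: "card (single C B) < card (single C T)"
      unfolding blocked_def by blast
    have B': "single C' B \<subseteq> single C B - {x, y}" and T': "single C' T = single C T - {x, y}"
      using xy unfolding single_def C' by auto
    have finS: "finite (single C B)" "finite (single C T)"
      using finB finT unfolding single_def by auto
    have leB: "card (single C' B) \<le> card (single C B - {x, y})"
      using B' finS by (intro card_mono) auto
    \<comment> \<open>Off \<open>t\<close> the merged stack has at most two cups, so both parts were
      single.\<close>
    have y1: "C y = 1 \<and> C x = 1" if "y \<noteq> t"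
      using small[OF xy(2) that] xy unfolding C' by auto
    have edge: "x \<rightarrow>\<^bsub>G\<^esub> y" if "C x = 1"
      using graph_dist_eq_1_imp_adj[OF xy(3)] d that by (simp add: one_ereal_def)
    \<comment> \<open>If the move touches a single cup of \<open>T\<close>, as mover or as receiver,
      both sets lose exactly one single cup and the strict inequality survives.\<close>
    consider (none) "x \<notin> single C T" "y \<notin> single C T" | (x) "x \<in> single C T" | (y) "y \<in> single C T"
      by blast
    then show False
    proof cases
      case none
      then have "single C' T = single C T" using T' by blast
      moreover have "card (single C' B) \<le> card (single C B)"
        using B' finS by (intro card_mono) auto
      ultimately show False using lt nb unfolding blocked_def by auto
    next
      case x
      then have yB: "y \<in> B" using edge adj(1) unfolding single_def by auto
      then have yS: "y \<in> single C B" using y1 t unfolding single_def by auto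
      have "x \<notin> single C B" "y \<notin> single C T" using x yB disj unfolding single_def by auto
      then have "single C B - {x, y} = single C B - {y}" "single C T - {x, y} = single C T - {x}"
        by auto
      then show False
        using leB T' lt nb card.remove[OF finS(1) yS] card.remove[OF finS(2) x]
        unfolding blocked_def by auto
    next
      case y
      then have "y \<noteq> t" using t unfolding single_def by auto
      then have xS: "x \<in> single C B" using y1 edge adj(2) y unfolding single_def by auto
      have "y \<notin> single C B" "x \<notin> single C T" using y xS disj unfolding single_def by auto
      then have "single C B - {x, y} = single C B - {x}" "single C T - {x, y} = single C T - {y}"
        by auto
      then show False
        using leB T' lt nb card.remove[OF finS(1) xS] card.remove[OF finS(2) y]
        unfolding blocked_def by auto
    qed
  qed
  assume "stackable G t"
  then obtain C where reach: "(cup_move G)\<^sup>*\<^sup>* (initial_cups G) C"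
    and final: "\<And>v. v \<in> verts G \<Longrightarrow> v \<noteq> t \<Longrightarrow> C v = 0"
    unfolding stackable_def by blast
  have "single (initial_cups G) A = A" if "A \<subseteq> verts G" for A
    using that unfolding single_def initial_cups_def by auto
  then have "blocked (initial_cups G)"
    using sub card unfolding blocked_def by simp
  with reach have "blocked C"
    by (induction rule: rtranclp_induct) (auto intro: step)
  moreover have "single C T = {}"
    using final sub t unfolding single_def by fastforce
  ultimately show False
    using final unfolding blocked_def by auto
qed

end

section \<open>The punctured clique: connectivity and non-stackability\<close>

text \<open>
  The clique is \<open>{..<k}\<close>, and \<open>v \<ge> k\<close> is attached to all clique vertices except \<open>v mod k\<close>.
\<close>

definition punctured_clique_graph :: "nat \<Rightarrow> nat pair_pre_digraph" where
  "punctured_clique_graph k = \<lparr> pverts = {..<k + k * k},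
     parcs = {(u, v). u < k + k * k \<and> v < k + k * k \<and> (u < k \<or> v < k) \<and> u mod k \<noteq> v mod k} \<rparr>"

lemma verts_punctured_clique_graph [simp]:
  "pverts (punctured_clique_graph k) = {..<k + k * k}"
  by (simp add: punctured_clique_graph_def)

lemma parcs_punctured_clique_graph:
  "(u, v) \<in> parcs (punctured_clique_graph k) \<longleftrightarrow>
     u < k + k * k \<and> v < k + k * k \<and> (u < k \<or> v < k) \<and> u mod k \<noteq> v mod k"
  by (simp add: punctured_clique_graph_def)

lemma pair_graph_punctured_clique_graph: "pair_graph (punctured_clique_graph k)"
proof -
  have "finite (parcs (punctured_clique_graph k))"
    by (rule finite_subset[of _ "{..<k + k * k} \<times> {..<k + k * k}"])
      (auto simp: punctured_clique_graph_def)
  then show ?thesis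
    by unfold_locales
      (auto simp: parcs_punctured_clique_graph symmetric_def intro!: symI)
qed

text \<open>The only clique vertex not adjacent to \<open>u\<close> is \<open>u mod k\<close>, which
  is \<open>u\<close> itself if \<open>u < k\<close>. So at most \<open>card S + 2\<close> clique
  vertices are excluded. Taking \<open>S\<close> empty bounds the diameter; taking \<open>S\<close>
  as the deleted set gives connectivity.\<close>

lemma punctured_clique_graph_common_neighbour:
  assumes "u < k + k * k" "v < k + k * k" "finite S" "card S + 2 < k"
  obtains z where "z < k" "z \<notin> S"
    "(u, z) \<in> parcs (punctured_clique_graph k)" "(z, v) \<in> parcs (punctured_clique_graph k)"
proof -
  have "card (S \<union> {u mod k, v mod k}) \<le> card S + card {u mod k, v mod k}"
    by (rule card_Un_le)
  also have "\<dots> \<le> card S + 2"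
    by (simp add: card_insert_if)
  finally have "\<not> {..<k} \<subseteq> S \<union> {u mod k, v mod k}"
    using assms card_mono[of "S \<union> {u mod k, v mod k}" "{..<k}"] by auto
  then obtain z where "z < k" "z \<notin> S" "z \<noteq> u mod k" "z \<noteq> v mod k"
    by auto
  with assms that show ?thesis
    by (auto simp: parcs_punctured_clique_graph)
qed

lemma vertex_connected_punctured_clique_graph:
  assumes "c + 2 \<le> k"
  shows "vertex_connected c (with_proj (punctured_clique_graph k))"
  unfolding vertex_connected_def
proof (intro conjI allI impI)
  let ?G = "with_proj (punctured_clique_graph k)"
  show "c < card (verts ?G)"
    using assms by simp
  fix S assume S: "S \<subseteq> verts ?G" "card S < c"
  have finS: "finite S" using S(1) by (simp add: finite_subset)
  interpret pair_graph "punctured_clique_graph k"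
    by (rule pair_graph_punctured_clique_graph)
  let ?H = "?G \<restriction> (verts ?G - S)"
  interpret H: wf_digraph ?H by (rule wellformed_induce_subgraph)
  have "(u, v) \<in> rtrancl_on (verts ?H) ((arcs_ends ?H)\<^sup>s)"
    if uv: "u \<in> verts ?H" "v \<in> verts ?H" for u v
  proof -
    obtain z where z: "z < k" "z \<notin> S" "(u, z) \<in> arcs ?G" "(z, v) \<in> arcs ?G"
      using punctured_clique_graph_common_neighbour[of u k v S] uv S assms finS by auto
    have "(u, z) \<in> arcs_ends ?H" "(z, v) \<in> arcs_ends ?H"
      using z uv by (force simp: arcs_ends_conv)+
    then have "(u, z) \<in> (arcs_ends ?H)\<^sup>s" "(z, v) \<in> (arcs_ends ?H)\<^sup>s"
      by (simp_all add: symcl_def)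
    then show ?thesis
      using uv z
      by (meson H.adj_in_verts \<open>(u, z) \<in> arcs_ends ?H\<close> rtrancl_on_into_rtrancl_on rtrancl_on_refl)
  qed
  moreover obtain z where "z < k" "z \<notin> S"
    \<comment> \<open>Connectedness includes non-emptiness; any surviving clique vertex will
      do.\<close>
    using punctured_clique_graph_common_neighbour[of 0 k 0 S] S assms finS by auto
  then have "z \<in> verts ?H" by simp
  then have "verts ?H \<noteq> {}" by blast
  ultimately show "Digraph_Component.connected ?H"
    by (simp add: Digraph_Component.connected_conv)
qed

text \<open>For \<open>t\<close> in the clique, the \<open>k\<close> vertices attached to everything
  but \<open>t\<close> compete for \<open>k - 1\<close> neighbours. Otherwise the other
  \<open>k * k - 1\<close> attached vertices compete for the \<open>k\<close> clique
  vertices.\<close>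

lemma strongly_non_stackable_punctured_clique_graph:
  assumes "3 \<le> k"
  shows "strongly_non_stackable (with_proj (punctured_clique_graph k))"
  unfolding strongly_non_stackable_def
proof
  let ?P = "punctured_clique_graph k"
  let ?G = "with_proj ?P"
  fix t assume t: "t \<in> verts ?G"
  interpret pair_graph "punctured_clique_graph k"
    by (rule pair_graph_punctured_clique_graph)
  have diam: "graph_dist ?G x y \<le> 2" if xy: "x \<in> pverts ?P" "y \<in> pverts ?P" for x y
  proof -
    obtain z where "(x, z) \<in> parcs ?P" "(z, y) \<in> parcs ?P"
      by (rule punctured_clique_graph_common_neighbour[of x k y "{}"]) (use xy assms in auto)
    then show ?thesis
      using graph_dist_le_2[of x z y] by simp
  qed
  show "\<not> stackable ?G t"
  proof (cases "t < k")
    case True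
    \<comment> \<open>The residue class of \<open>t\<close> modulo \<open>k\<close>;
      \<open>Suc\<close> skips \<open>t\<close> itself.\<close>
    let ?T = "(\<lambda>j. t + Suc j * k) ` {..<k}"
    have bound: "t + Suc j * k < k + k * k" if "j < k" for j
    proof -
      have "Suc j * k \<le> k * k" using that by (intro mult_right_mono) auto
      then show ?thesis using True by linarith
    qed
    have mod: "v mod k = t" "v \<ge> k" if "v \<in> ?T" for v
      using that True by (auto simp del: mult_Suc) simp
    have "card ?T = k"
      using assms by (subst card_image) (auto simp: inj_on_def)
    moreover have "card ({..<k} - {t}) = k - 1"
      using True by simp
    ultimately have card: "card ({..<k} - {t}) < card ?T"
      using assms by simp
    have sub: "?T \<subseteq> pverts ?P"
      using bound by auto
    show ?thesis
    proof (rule not_stackable_if_few_neighbours[OF diam _ sub _ _ _ _ _ _ card])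
      fix x y assume arc: "(x, y) \<in> parcs ?P"
      show "y \<in> {..<k} - {t}" if "x \<in> ?T"
        using mod[OF that] arc by (auto simp: parcs_punctured_clique_graph)
      show "x \<in> {..<k} - {t}" if "y \<in> ?T"
        using mod[OF that] arc by (auto simp: parcs_punctured_clique_graph)
    qed (use True in auto)
  next
    case False
    \<comment> \<open>A linear bound on the square, enough for \<open>k < k * k - 1\<close>.\<close>
    have "k * k \<ge> 3 * k" using assms by (intro mult_right_mono) auto
    moreover have "card ({k..<k + k * k} - {t}) = k * k - 1"
      using False t by simp
    ultimately have card: "card {..<k} < card ({k..<k + k * k} - {t})"
      using assms unfolding card_lessThan by linarith
    show ?thesis
    proof (rule not_stackable_if_few_neighbours[OF diam _ _ _ _ _ _ _ _ card])
      fix x y assume arc: "(x, y) \<in> parcs ?P"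
      show "y \<in> {..<k}" if "x \<in> {k..<k + k * k} - {t}"
        using that arc by (simp add: parcs_punctured_clique_graph)
      show "x \<in> {..<k}" if "y \<in> {k..<k + k * k} - {t}"
        using that arc by (simp add: parcs_punctured_clique_graph)
    qed (use False in auto)
  qed
qed

theorem theorem4p4:
  fixes c :: nat
  assumes "c \<ge> 1"
  shows "\<exists>G :: nat pair_pre_digraph.
           pair_graph G \<and> vertex_connected c (with_proj G) \<and> strongly_non_stackable (with_proj G)"
proof (intro exI conjI)
  show "pair_graph (punctured_clique_graph (c + 2))"
    by (rule pair_graph_punctured_clique_graph)
  show "vertex_connected c (with_proj (punctured_clique_graph (c + 2)))"
    by (rule vertex_connected_punctured_clique_graph) simp
  \<comment> \<open>Here \<open>c \<ge> 1\<close> supplies \<open>3 \<le> c + 2\<close>.\<close>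
  show "strongly_non_stackable (with_proj (punctured_clique_graph (c + 2)))"
    by (rule strongly_non_stackable_punctured_clique_graph) (use assms in simp)
qed

end
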